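(* Let $G$ be a finite simple undirected graph and let $\mathcal{M}$ be a given MCB of $G$. (i) If $C_2\in\mathcal{M}$, $C_1\in\mathcal{C}_{\mathcal{R}}\setminus\mathcal{M}$, $C_2\in\mathcal{E}_{\mathcal{M}}(C_1)$ and $|C_1|=|C_2|$, then $C_1\sim_{\mathtt{pi}}C_2$. (ii) The equivalence classes of $\sim_{\mathtt{pi}}$ on $\mathcal{C}_{\mathcal{R}}$ coincide with the equivalence classes of the transitive closure of these relations, i.e., of the smallest equivalence relation on $\mathcal{C}_{\mathcal{R}}$ containing all pairs $(C_1,C_2)$ with $C_1\in\mathcal{C}_{\mathcal{R}}\setminus\mathcal{M}$, $C_2\in\mathcal{M}\cap\mathcal{E}_{\mathcal{M}}(C_1)$ and $|C_1|=|C_2|$.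
   Context: Let $G=(V,E)$ be a finite simple undirected graph. A cycle is a set $C\subseteq E$ such that every vertex of $G$ has even degree in the subgraph with edge set $C$; $|C|$ denotes the number of edges. The cycles form a vector space over $GF(2)$ with addition the symmetric difference $\oplus$. A cycle basis is a basis of this space; a minimum cycle basis (MCB) is a cycle basis $\mathcal{M}$ minimizing $\sum_{B\in\mathcal{M}}|B|$. The set of relevant cycles $\mathcal{C}_{\mathcal{R}}$ is the union of all MCBs. For a cycle basis $\mathcal{B}$ and a cycle $C$, the expansion $\mathcal{E}_{\mathcal{B}}(C)$ is the unique subset of $\mathcal{B}$ whose $\oplus$-sum is $C$. For $C_1,C_2\in\mathcal{C}_{\mathcal{R}}$, $C_1\sim_{\mathtt{pi}}C_2$ means there exists an MCB $\mathcal{M}_2$ with $C_2\in\mathcal{M}_2$ such that $(\mathcal{M}_2\setminus\{C_2\})\cup\{C_1\}$ is also an MCB; this is an equivalence relation on $\mathcal{C}_{\mathcal{R}}$. *)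

theory Defs
  imports Complex_Main "HOL-Library.Z2" "HOL-Library.Function_Algebras"
begin

text \<open>
  Type \<^typ>\<open>bit\<close> is the field GF(2).  An edge set is identified with its
  characteristic vector, so that the linear algebra of the library applies; symmetric
  difference of edge sets is addition of vectors (lemma \<open>char_vec_sym_diff\<close> below).
\<close>

definition char_vec :: "'e set \<Rightarrow> 'e \<Rightarrow> bit" where
  "char_vec C = (\<lambda>e. of_bool (e \<in> C))"

global_interpretation gf2: vector_space "\<lambda>(c::bit) (x::'e \<Rightarrow> bit). (\<lambda>e. c * x e)"
  by unfold_locales (auto simp: fun_eq_iff distrib_left distrib_right mult.assoc)

lemma char_vec_inject: "char_vec C = char_vec D \<longleftrightarrow> C = D"
  by (auto simp: char_vec_def fun_eq_iff)

lemma inj_char_vec: "inj_on char_vec A"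
  by (auto simp: inj_on_def char_vec_inject)

lemma char_vec_empty: "char_vec {} = 0"
  by (simp add: char_vec_def fun_eq_iff)

lemma char_vec_sym_diff: "char_vec (sym_diff C D) = char_vec C + char_vec D"
  by (auto simp: char_vec_def fun_eq_iff)

definition finite_simple_graph :: "'v set \<Rightarrow> 'v set set \<Rightarrow> bool" where
  "finite_simple_graph V E \<longleftrightarrow> finite V \<and> (\<forall>e\<in>E. e \<subseteq> V \<and> card e = 2)"

definition cycles :: "'v set \<Rightarrow> 'v set set \<Rightarrow> 'v set set set" where
  "cycles V E = {C. C \<subseteq> E \<and> (\<forall>v\<in>V. even (card {e \<in> C. v \<in> e}))}"

definition cycle_basis :: "'v set \<Rightarrow> 'v set set \<Rightarrow> 'v set set set \<Rightarrow> bool" where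
  "cycle_basis V E B \<longleftrightarrow>
     B \<subseteq> cycles V E \<and>
     gf2.independent (char_vec ` B) \<and>
     gf2.span (char_vec ` B) = char_vec ` cycles V E"

definition mcb :: "'v set \<Rightarrow> 'v set set \<Rightarrow> 'v set set set \<Rightarrow> bool" where
  "mcb V E B \<longleftrightarrow>
     cycle_basis V E B \<and>
     (\<forall>B'. cycle_basis V E B' \<longrightarrow> (\<Sum>C\<in>B. card C) \<le> (\<Sum>C\<in>B'. card C))"

definition relevant_cycles :: "'v set \<Rightarrow> 'v set set \<Rightarrow> 'v set set set" where
  "relevant_cycles V E = \<Union>{B. mcb V E B}"

text \<open>
  The subset of \<open>B\<close> whose sum over GF(2) is \<open>C\<close>.  It exists and is unique when \<open>B\<close> is a cycle
  basis of a finite graph and \<open>C\<close> is a cycle (lemma \<open>expansion_unique\<close> below); the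
  description is meaningful only then.
\<close>

definition expansion :: "'v set set set \<Rightarrow> 'v set set \<Rightarrow> 'v set set set" where
  "expansion B C = (THE F. F \<subseteq> B \<and> (\<Sum>D\<in>F. char_vec D) = char_vec C)"

definition pi_rel :: "'v set \<Rightarrow> 'v set set \<Rightarrow> ('v set set \<times> 'v set set) set" where
  "pi_rel V E =
     {(C1, C2). C1 \<in> relevant_cycles V E \<and> C2 \<in> relevant_cycles V E \<and>
        (\<exists>M2. mcb V E M2 \<and> C2 \<in> M2 \<and> mcb V E ((M2 - {C2}) \<union> {C1}))}"

definition exchange_pairs ::
  "'v set \<Rightarrow> 'v set set \<Rightarrow> 'v set set set \<Rightarrow> ('v set set \<times> 'v set set) set" where
  "exchange_pairs V E M =
     {(C1, C2). C1 \<in> relevant_cycles V E - M \<and> C2 \<in> M \<inter> expansion M C1 \<and> card C1 = card C2}"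

definition least_equiv :: "'a set \<Rightarrow> ('a \<times> 'a) set \<Rightarrow> ('a \<times> 'a) set" where
  "least_equiv A r = \<Inter>{s. equiv A s \<and> r \<subseteq> s}"

lemma finite_simple_graph_finite_edges: "finite_simple_graph V E \<Longrightarrow> finite E"
  unfolding finite_simple_graph_def by (rule finite_subset[of _ "Pow V"]) auto

lemma finite_cycles: "finite_simple_graph V E \<Longrightarrow> finite (cycles V E)"
  by (rule finite_subset[of _ "Pow E"])
    (auto simp: cycles_def finite_simple_graph_finite_edges)

lemma sym_diff_cycles:
  assumes "finite_simple_graph V E" "C \<in> cycles V E" "D \<in> cycles V E"
  shows "sym_diff C D \<in> cycles V E"
proof -
  have fin: "finite C" "finite D"
    using assms finite_simple_graph_finite_edges[OF assms(1)]
    by (auto simp: cycles_def intro: finite_subset)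
  have "even (card {e \<in> sym_diff C D. v \<in> e})" if "v \<in> V" for v
  proof -
    let ?C = "{e \<in> C. v \<in> e}" and ?D = "{e \<in> D. v \<in> e}"
    have "card ?C = card (?C \<inter> ?D) + card (?C - ?D)" "card ?D = card (?D \<inter> ?C) + card (?D - ?C)"
      using fin by (simp_all add: card_Int_Diff)
    moreover have "?D \<inter> ?C = ?C \<inter> ?D" by blast
    moreover have "{e \<in> sym_diff C D. v \<in> e} = (?C - ?D) \<union> (?D - ?C)" by blast
    then have "card {e \<in> sym_diff C D. v \<in> e} = card (?C - ?D) + card (?D - ?C)"
      using fin by (simp only:) (rule card_Un_disjoint, auto)
    moreover have "even (card ?C)" "even (card ?D)"
      using assms that by (auto simp: cycles_def)
    ultimately show ?thesis by (simp only: even_add)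
  qed
  then show ?thesis
    using assms by (auto simp: cycles_def)
qed

lemma subspace_cycles:
  assumes "finite_simple_graph V E"
  shows "gf2.subspace (char_vec ` cycles V E)"
proof -
  have "{} \<in> cycles V E" by (simp add: cycles_def)
  then have zero: "0 \<in> char_vec ` cycles V E"
    by (metis char_vec_empty image_eqI)
  have add: "x + y \<in> char_vec ` cycles V E"
    if "x \<in> char_vec ` cycles V E" "y \<in> char_vec ` cycles V E" for x y
    using that sym_diff_cycles[OF assms] by (auto simp flip: char_vec_sym_diff)
  have scale: "(\<lambda>e. c * x e) \<in> char_vec ` cycles V E" if "x \<in> char_vec ` cycles V E" for c :: bit and x
    using that zero by (cases c) (simp_all only: mult_zero_left mult_1_left zero_fun_def)
  show ?thesis
    unfolding gf2.subspace_def using zero add scale by blast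
qed

lemma expansion_unique:
  assumes "finite_simple_graph V E" "cycle_basis V E B" "C \<in> cycles V E"
  shows "\<exists>!F. F \<subseteq> B \<and> (\<Sum>D\<in>F. char_vec D) = char_vec C"
proof -
  have fin: "finite B"
    using assms finite_cycles finite_subset by (metis cycle_basis_def)
  have scale: "(\<Sum>D\<in>B. (\<lambda>e. u (char_vec D) * char_vec D e)) = (\<Sum>D\<in>{D\<in>B. u (char_vec D) = 1}. char_vec D)"
    for u :: "_ \<Rightarrow> bit"
    by (subst sum.inter_filter[OF fin]) (auto intro!: sum.cong simp: zero_fun_def)
  have "char_vec C \<in> gf2.span (char_vec ` B)"
    using assms by (auto simp: cycle_basis_def)
  then obtain u where "char_vec C = (\<Sum>x\<in>char_vec ` B. (\<lambda>e. u x * x e))"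
    using gf2.span_finite[of "char_vec ` B"] fin by auto
  then have ex: "(\<Sum>D\<in>{D\<in>B. u (char_vec D) = 1}. char_vec D) = char_vec C"
    by (simp only: sum.reindex[OF inj_char_vec] o_def scale)
  have uniq: "F = F'" if F: "F \<subseteq> B" "F' \<subseteq> B"
    "(\<Sum>D\<in>F. char_vec D) = char_vec C" "(\<Sum>D\<in>F'. char_vec D) = char_vec C" for F F'
  proof -
    define w where "w S x = (of_bool (x \<in> char_vec ` S) :: bit)" for S :: "'a set set set" and x
    have w: "(\<Sum>x\<in>char_vec ` B. (\<lambda>e. w S x * x e)) = (\<Sum>D\<in>S. char_vec D)" if "S \<subseteq> B" for S
    proof -
      have "{D \<in> B. w S (char_vec D) = 1} = S"
        using that by (auto simp: w_def char_vec_inject image_iff)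
      then show ?thesis
        by (simp only: sum.reindex[OF inj_char_vec] o_def scale)
    qed
    have "(\<Sum>x\<in>char_vec ` B. (\<lambda>e. (w F x - w F' x) * x e)) =
        (\<Sum>x\<in>char_vec ` B. (\<lambda>e. w F x * x e)) - (\<Sum>x\<in>char_vec ` B. (\<lambda>e. w F' x * x e))"
      unfolding sum_subtractf[symmetric]
      by (intro sum.cong refl ext) (simp only: left_diff_distrib fun_diff_def)
    also have "\<dots> = 0"
      using w[OF F(1)] w[OF F(2)] F(3,4) by (simp only: diff_self)
    finally have "(\<Sum>x\<in>char_vec ` B. (\<lambda>e. (w F x - w F' x) * x e)) = 0" .
    then have z: "w F x - w F' x = 0" if "x \<in> char_vec ` B" for x
      using assms(2) fin that gf2.independentD[of "char_vec ` B" "char_vec ` B" "\<lambda>x. w F x - w F' x"]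
      by (auto simp: cycle_basis_def)
    have "D \<in> F \<longleftrightarrow> D \<in> F'" if "D \<in> B" for D
      using z[of "char_vec D"] that by (auto simp: w_def char_vec_inject image_iff split: if_splits)
    then show ?thesis using F by blast
  qed
  show ?thesis
  proof (rule ex1I)
    show main: "{D\<in>B. u (char_vec D) = 1} \<subseteq> B \<and>
        (\<Sum>D\<in>{D\<in>B. u (char_vec D) = 1}. char_vec D) = char_vec C"
      using ex by blast
    show "F = {D\<in>B. u (char_vec D) = 1}"
      if "F \<subseteq> B \<and> (\<Sum>D\<in>F. char_vec D) = char_vec C" for F
      using that main uniq by blast
  qed
qed

end

theory Submission
  imports Defs
begin

text \<open>
  Minimum cycle bases are the minimum weight bases of the matroid of cycles under linear
  independence, and only the closure operator of this matroid matters.  Fix one such basis \<open>M\<close>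
  and join \<open>a \<notin> M\<close> to \<open>b \<in> M\<close> whenever \<open>a\<close> has the same weight as \<open>b\<close> and \<open>b\<close> occurs in the
  expansion of \<open>a\<close>.  If a set \<open>K\<close> is a union of components of this bipartite graph, then a
  dimension count shows that all minimum weight bases have equally many elements of each given
  weight in \<open>K\<close>; so an exchange between two of them cannot leave a component.
  Conversely, on a chordless path \<open>x, p\<^sub>1, p\<^sub>2, p\<^sub>3, \<dots>\<close> exchanging \<open>p\<^sub>1\<close> and \<open>p\<^sub>2\<close> in \<open>M\<close> yields a
  minimum weight basis for which \<open>x, p\<^sub>3, \<dots>\<close> is a path with the same end points.  Iterating this
  makes the end points exchangeable for each other.
\<close>

section \<open>Minimum weight bases of a matroid given by its closure operator\<close>

text \<open>With \<open>cl_extensive\<close>, the law \<open>cl_least\<close> yields monotonicity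
  and idempotence. The laws range over all sets of the type, as for a linear span, so closures may
  leave \<open>X\<close>; hence \<open>basis\<close> asks for \<open>X \<subseteq> cl B\<close>
  instead of an equality.\<close>

locale weighted_matroid =
  fixes X :: "'a set" and cl :: "'a set \<Rightarrow> 'a set" and w :: "'a \<Rightarrow> nat"
  assumes finite_ground: "finite X"
    and cl_extensive: "A \<subseteq> cl A"
    and cl_least: "A \<subseteq> cl B \<Longrightarrow> cl A \<subseteq> cl B"
    and cl_exchange: "x \<in> cl (insert y A) \<Longrightarrow> x \<notin> cl A \<Longrightarrow> y \<in> cl (insert x A)"
begin

definition indep :: "'a set \<Rightarrow> bool" where
  "indep A \<longleftrightarrow> (\<forall>a\<in>A. a \<notin> cl (A - {a}))"

definition basis :: "'a set \<Rightarrow> bool" where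
  "basis B \<longleftrightarrow> B \<subseteq> X \<and> indep B \<and> X \<subseteq> cl B"

definition min_basis :: "'a set \<Rightarrow> bool" where
  "min_basis B \<longleftrightarrow> basis B \<and> (\<forall>B'. basis B' \<longrightarrow> sum w B \<le> sum w B')"

definition relevant :: "'a set" where
  "relevant = \<Union>{B. min_basis B}"

definition interchange :: "('a \<times> 'a) set" where
  "interchange = {(a, b). a \<in> relevant \<and> b \<in> relevant \<and>
     (\<exists>B. min_basis B \<and> b \<in> B \<and> min_basis ((B - {b}) \<union> {a}))}"

text \<open>For a basis \<open>M\<close>, the condition \<open>a \<notin> cl (M - {b})\<close> says that \<open>b\<close> lies in the expansion of \<open>a\<close>.\<close>

definition pivots :: "'a set \<Rightarrow> ('a \<times> 'a) set" where
  "pivots M = {(a, b). a \<in> relevant - M \<and> b \<in> M \<and> a \<notin> cl (M - {b}) \<and> w a = w b}"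

section \<open>Closure, independence and Steinitz exchange\<close>

lemma cl_mono: "A \<subseteq> B \<Longrightarrow> cl A \<subseteq> cl B"
  using cl_least cl_extensive by (meson order_trans)

lemma cl_mono_in: "x \<in> cl A \<Longrightarrow> A \<subseteq> B \<Longrightarrow> x \<in> cl B"
  using cl_mono by blast

lemma cl_superset_in: "x \<in> A \<Longrightarrow> x \<in> cl A"
  using cl_extensive by blast

lemma cl_insert_absorb: "a \<in> cl B \<Longrightarrow> A \<subseteq> B \<Longrightarrow> x \<in> cl (insert a A) \<Longrightarrow> x \<in> cl B"
  using cl_least[of "insert a A" B] cl_extensive[of B] by blast

lemma indep_subset: "indep B \<Longrightarrow> A \<subseteq> B \<Longrightarrow> indep A"
  unfolding indep_def by (meson Diff_mono cl_mono_in order_refl subsetD)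

lemma indep_insert:
  assumes "indep A" "b \<notin> cl A"
  shows "indep (insert b A)"
  unfolding indep_def
proof
  have b: "b \<notin> A" using assms(2) cl_extensive by blast
  fix c assume c: "c \<in> insert b A"
  show "c \<notin> cl (insert b A - {c})"
  proof (cases "c = b")
    case True
    then show ?thesis using assms(2) b by simp
  next
    case False
    then have "c \<in> A" using c by simp
    then have "c \<notin> cl (A - {c})" and eq: "insert c (A - {c}) = A"
      using assms(1) by (auto simp: indep_def)
    then have "c \<notin> cl (insert b (A - {c}))"
      using cl_exchange[of c b "A - {c}"] assms(2) by auto
    moreover have "insert b A - {c} = insert b (A - {c})" using False by auto
    ultimately show ?thesis by simp
  qed
qed

text \<open>Steinitz exchange: replacing an element of \<open>A\<close> outside \<open>B\<close> by
  one of \<open>B\<close> keeps size and independence and shrinks \<open>A - B\<close>, until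
  \<open>A \<subseteq> B\<close>.\<close>

lemma card_indep_le:
  assumes "finite A" "finite B" "indep A" "A \<subseteq> cl B"
  shows "card A \<le> card B"
  using assms
proof (induction "card (A - B)" arbitrary: A rule: less_induct)
  case less
  show ?case
  proof (cases "A \<subseteq> B")
    case True
    then show ?thesis using less.prems by (simp add: card_mono)
  next
    case False
    then obtain a where a: "a \<in> A" "a \<notin> B" by blast
    have "a \<notin> cl (A - {a})" using less.prems a by (auto simp: indep_def)
    \<comment> \<open>Otherwise \<open>a \<in> cl B \<subseteq> cl (A - {a})\<close>.\<close>
    then have "\<not> B \<subseteq> cl (A - {a})" using cl_least less.prems a by blast
    then obtain b where b: "b \<in> B" "b \<notin> cl (A - {a})" by blast
    let ?A = "insert b (A - {a})"
    have bA: "b \<notin> A - {a}" using b(2) cl_superset_in[of b "A - {a}"] by auto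
    have "?A - B \<subset> A - B" using a b by auto
    then have "card (?A - B) < card (A - B)"
      using less.prems by (intro psubset_card_mono) auto
    moreover have "indep ?A" using b less.prems by (meson Diff_subset indep_insert indep_subset)
    moreover have "?A \<subseteq> cl B" using b less.prems cl_superset_in[of b B] by auto
    ultimately have "card ?A \<le> card B" using less.hyps less.prems by auto
    moreover have "card ?A = card A"
      using bA card.remove[OF less.prems(1) a(1)] less.prems by simp
    ultimately show ?thesis by simp
  qed
qed

text \<open>Stands in for uniqueness of expansions: elements of \<open>M\<close> that can be spared
  one at a time in spanning \<open>x\<close> can be spared all together.\<close>

lemma in_cl_expansion:
  assumes "finite M" "indep M" "x \<in> cl M" "T \<subseteq> M" and T: "\<And>b. b \<in> M - T \<Longrightarrow> x \<in> cl (M - {b})"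
  shows "x \<in> cl T"
proof -
  have "x \<in> cl (M - S)" if "finite S" "S \<subseteq> M - T" for S
    using that
  proof (induction S rule: finite_induct)
    case empty
    then show ?case using assms by simp
  next
    case (insert b S)
    then have b: "b \<in> M" "b \<notin> S" "x \<in> cl (M - {b})" and x: "x \<in> cl (M - S)"
      using T by auto
    show ?case
    proof (rule ccontr)
      \<comment> \<open>If dropping \<open>b\<close> after \<open>S\<close> loses \<open>x\<close>,
        then \<open>b\<close> depends on \<open>x\<close> and \<open>M - insert b S\<close>; as
        \<open>x\<close> is spanned without \<open>b\<close>, this contradicts independence of
        \<open>M\<close>.\<close>
      assume "x \<notin> cl (M - insert b S)"
      moreover have "insert b (M - insert b S) = M - S" using b by auto
      ultimately have "b \<in> cl (insert x (M - insert b S))"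
        using cl_exchange x by metis
      then have "b \<in> cl (M - {b})"
        by (rule cl_insert_absorb[OF b(3), rotated]) auto
      then show False using b assms by (auto simp: indep_def)
    qed
  qed
  from this[of "M - T"] show ?thesis
    using assms by (simp add: double_diff)
qed

section \<open>Bases, single exchanges and their weights\<close>

lemma min_basisD:
  assumes "min_basis B"
  shows "basis B" "finite B" "indep B" "B \<subseteq> X" "X \<subseteq> cl B" "B \<subseteq> relevant"
  using assms finite_ground finite_subset by (auto simp: min_basis_def basis_def relevant_def)

lemma relevant_subset: "relevant \<subseteq> X"
  using min_basisD(4) unfolding relevant_def by blast

lemma card_basis_eq:
  assumes "basis A" "basis B"
  shows "card A = card B"
proof -
  have "finite A" "finite B" "A \<subseteq> cl B" "B \<subseteq> cl A"
    using assms finite_ground by (auto simp: basis_def intro: finite_subset)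
  then show ?thesis
    using assms card_indep_le by (metis basis_def le_antisym)
qed

lemma basis_exchange:
  assumes "basis M" "b \<in> M" "a \<in> X" "a \<notin> cl (M - {b})"
  shows "basis (insert a (M - {b}))"
proof -
  have eq: "insert b (M - {b}) = M" using assms by auto
  then have "b \<in> cl (insert a (M - {b}))"
    using cl_exchange[of a b "M - {b}"] assms by (auto simp: basis_def)
  moreover have "M - {b} \<subseteq> cl (insert a (M - {b}))"
    using cl_extensive[of "insert a (M - {b})"] by blast
  ultimately have "M \<subseteq> cl (insert a (M - {b}))" using eq by blast
  then have "cl M \<subseteq> cl (insert a (M - {b}))" by (rule cl_least)
  moreover have "indep (insert a (M - {b}))"
    using assms indep_subset[of M "M - {b}"] by (intro indep_insert) (auto simp: basis_def)
  ultimately show ?thesis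
    using assms by (auto simp: basis_def)
qed

lemma sum_exchange:
  assumes "finite M" "b \<in> M" "a \<notin> M - {b}"
  shows "sum w (insert a (M - {b})) + w b = sum w M + w a"
  using assms sum.remove[OF assms(1,2), of w] by simp

text \<open>Otherwise trading \<open>b\<close> for \<open>a\<close> would give a lighter basis. Thus
  no element of an expansion over a minimum basis is heavier than the expanded element.\<close>

lemma weight_le_if_exchange:
  assumes "min_basis M" "b \<in> M" "a \<in> X" "a \<notin> cl (M - {b})"
  shows "w b \<le> w a"
proof -
  have le: "sum w M \<le> sum w (insert a (M - {b}))"
    using assms basis_exchange by (auto simp: min_basis_def)
  have "a \<notin> M - {b}" using assms(4) cl_superset_in[of a "M - {b}"] by blast
  from sum_exchange[OF min_basisD(2)[OF assms(1)] assms(2) this]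
  show ?thesis using le by linarith
qed

lemma min_basis_exchange:
  assumes "min_basis M" "(a, b) \<in> pivots M"
  shows "min_basis (insert a (M - {b}))"
proof -
  have ab: "b \<in> M" "a \<in> X" "a \<notin> M" "a \<notin> cl (M - {b})" "w a = w b"
    using assms relevant_subset by (auto simp: pivots_def)
  then have "basis (insert a (M - {b}))" "sum w (insert a (M - {b})) = sum w M"
    using sum_exchange[of M b a] min_basisD[OF assms(1)] basis_exchange by auto
  then show ?thesis using assms(1) by (simp add: min_basis_def)
qed

lemma pivots_subset_interchange:
  assumes "min_basis M" "(a, b) \<in> pivots M"
  shows "(a, b) \<in> interchange"
  using assms min_basis_exchange[OF assms] min_basisD(6)[OF assms(1)]
  by (auto simp: interchange_def pivots_def)

text \<open>Bases have equal size, so the trade cannot lose an element; both bases have minimum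
  weight, so it cannot change the weight.\<close>

lemma interchangeD:
  assumes "min_basis B" "b \<in> B" "min_basis ((B - {b}) \<union> {a})"
  shows "a = b \<or> a \<notin> B" "w a = w b"
proof -
  have B: "finite B" "basis B" "basis (insert a (B - {b}))"
    using assms min_basisD by auto
  show ab: "a = b \<or> a \<notin> B"
  proof (rule ccontr)
    assume "\<not> ?thesis"
    then have "insert a (B - {b}) = B - {b}" by auto
    then show False
      using card_basis_eq[OF B(2,3)] B(1) assms(2) by (metis card_Diff1_less less_irrefl)
  qed
  have "sum w B = sum w (insert a (B - {b}))"
    using assms B by (simp add: min_basis_def le_antisym)
  then show "w a = w b"
    using sum_exchange[of B b a] ab assms B by auto
qed

lemma interchange_sym: "(a, b) \<in> interchange \<Longrightarrow> (b, a) \<in> interchange"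
proof -
  assume "(a, b) \<in> interchange"
  then obtain B where B: "a \<in> relevant" "b \<in> relevant" "min_basis B" "b \<in> B"
      "min_basis ((B - {b}) \<union> {a})"
    by (auto simp: interchange_def)
  have "((B - {b}) \<union> {a}) - {a} \<union> {b} = B"
    using interchangeD(1)[OF B(3-5)] B(4) by auto
  then show ?thesis
    using B unfolding interchange_def by (auto intro!: exI[of _ "insert a (B - {b})"])
qed

lemma interchange_refl: "a \<in> relevant \<Longrightarrow> (a, a) \<in> interchange"
  by (auto simp: interchange_def relevant_def insert_absorb)

section \<open>Interchangeable elements are joined by pivots\<close>

text \<open>Elements of \<open>A\<close> lighter than \<open>k\<close> expand over \<open>B\<close>
  using only elements lighter than \<open>k\<close>. By symmetry the counts below \<open>k\<close>
  agree, and a level is the difference of two such counts.\<close>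

lemma card_weight_level_eq:
  assumes "min_basis A" "min_basis B"
  shows "card {x \<in> A. w x < k} = card {x \<in> B. w x < k}"
    "card {x \<in> A. w x = k} = card {x \<in> B. w x = k}"
proof -
  have le: "card {x \<in> A. w x < k} \<le> card {x \<in> B. w x < k}"
    if "min_basis A" "min_basis B" for A B k
  proof (rule card_indep_le)
    show "{x \<in> A. w x < k} \<subseteq> cl {x \<in> B. w x < k}"
    proof
      fix x assume x: "x \<in> {x \<in> A. w x < k}"
      then have "x \<in> X" using min_basisD(4)[OF that(1)] by auto
      show "x \<in> cl {x \<in> B. w x < k}"
      proof (rule in_cl_expansion)
        show "x \<in> cl (B - {b})" if "b \<in> B - {x \<in> B. w x < k}" for b
          using weight_le_if_exchange[OF \<open>min_basis B\<close>, of b x] \<open>x \<in> X\<close> x that by force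
      qed (use min_basisD[OF that(2)] \<open>x \<in> X\<close> in auto)
    qed
  qed (use min_basisD(2,3)[OF that(1)] min_basisD(2)[OF that(2)] indep_subset[of A] in auto)
  have eq: "card {x \<in> A. w x < k} = card {x \<in> B. w x < k}" for k
    using le assms by (simp add: le_antisym)
  have Suc: "card {x \<in> C. w x < Suc k} = card {x \<in> C. w x < k} + card {x \<in> C. w x = k}"
    if "min_basis C" for C
  proof -
    have "{x \<in> C. w x < Suc k} = {x \<in> C. w x < k} \<union> {x \<in> C. w x = k}" by auto
    then show ?thesis using min_basisD(2)[OF that] by (simp add: card_Un_disjoint disjoint_iff)
  qed
  show "card {x \<in> A. w x < k} = card {x \<in> B. w x < k}" by (rule eq)
  show "card {x \<in> A. w x = k} = card {x \<in> B. w x = k}"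
    using eq[of k] eq[of "Suc k"] Suc assms by simp
qed

text \<open>The elements lighter than \<open>k\<close>, together with those of weight
  \<open>k\<close> in a union of components, expand within the same kind of elements of
  \<open>M\<close>. This bounds the count for \<open>B\<close> by that for \<open>M\<close>.\<close>

lemma card_level_Int_eq:
  assumes M: "min_basis M" and B: "min_basis B"
    and K: "\<And>a b. (a, b) \<in> pivots M \<Longrightarrow> a \<in> K \<longleftrightarrow> b \<in> K"
  shows "card {x \<in> B. w x = k \<and> x \<in> K} = card {x \<in> M. w x = k \<and> x \<in> K}"
proof -
  have le: "card {x \<in> B. w x = k \<and> x \<in> L} \<le> card {x \<in> M. w x = k \<and> x \<in> L}"
    if L: "\<And>a b. (a, b) \<in> pivots M \<Longrightarrow> a \<in> L \<longleftrightarrow> b \<in> L" for L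
  proof -
    let ?S = "\<lambda>B. {x \<in> B. w x < k \<or> w x = k \<and> x \<in> L}"
    have "card (?S B) \<le> card (?S M)"
    proof (rule card_indep_le)
      show "?S B \<subseteq> cl (?S M)"
      proof
        fix x assume x: "x \<in> ?S B"
        then have "x \<in> relevant" "x \<in> X" using min_basisD(4,6)[OF B] by auto
        show "x \<in> cl (?S M)"
        \<comment> \<open>Pivots start outside \<open>M\<close>, so elements of \<open>M\<close> are
          treated directly.\<close>
        proof (cases "x \<in> M")
          case True
          then show ?thesis using x by (intro cl_superset_in) blast
        next
          case False
          show ?thesis
          proof (rule in_cl_expansion)
            fix b assume b: "b \<in> M - ?S M"
            show "x \<in> cl (M - {b})"
            proof (rule ccontr)
              assume not: "x \<notin> cl (M - {b})"
              then have "w b \<le> w x" using weight_le_if_exchange M b \<open>x \<in> X\<close> by blast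
              then have "w x = w b" "x \<in> L" "b \<notin> L" using b x by auto
              then show False
                using L[of x b] not b False \<open>x \<in> relevant\<close> by (auto simp: pivots_def)
            qed
          qed (use min_basisD[OF M] \<open>x \<in> X\<close> in auto)
        qed
      qed
    qed (use min_basisD(2,3)[OF B] min_basisD(2)[OF M] indep_subset[of B] in auto)
    moreover have "card (?S C) = card {x \<in> C. w x < k} + card {x \<in> C. w x = k \<and> x \<in> L}"
      if "finite C" for C
    proof -
      have "?S C = {x \<in> C. w x < k} \<union> {x \<in> C. w x = k \<and> x \<in> L}" by auto
      then show ?thesis using that by (simp add: card_Un_disjoint disjoint_iff)
    qed
    ultimately show ?thesis
      using card_weight_level_eq(1)[OF M B] min_basisD(2)[OF M] min_basisD(2)[OF B] by simp
  qed
  have split: "card {x \<in> C. w x = k} =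
      card {x \<in> C. w x = k \<and> x \<in> K} + card {x \<in> C. w x = k \<and> x \<in> - K}" if "finite C" for C
  proof -
    have "{x \<in> C. w x = k} = {x \<in> C. w x = k \<and> x \<in> K} \<union> {x \<in> C. w x = k \<and> x \<in> - K}" by auto
    then show ?thesis using that by (simp add: card_Un_disjoint disjoint_iff)
  qed
  \<comment> \<open>The complement of \<open>K\<close> is also a union of components. Since whole
    levels have equal size, the two inequalities become equalities.\<close>
  have "card {x \<in> B. w x = k \<and> x \<in> - K} \<le> card {x \<in> M. w x = k \<and> x \<in> - K}"
    using K by (intro le) blast
  then show ?thesis
    using le[of K, OF K] split[of M] split[of B] min_basisD(2)[OF M] min_basisD(2)[OF B]
      card_weight_level_eq(2)[OF M B, of k] by linarith
qed

text \<open>Trading \<open>b\<close> in \<open>K\<close> for \<open>a\<close> outside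
  \<open>K\<close> would lower the number of elements of weight \<open>w b\<close> in
  \<open>K\<close>, which all minimum bases share.\<close>

lemma interchange_closed:
  assumes M: "min_basis M" and K: "\<And>a b. (a, b) \<in> pivots M \<Longrightarrow> a \<in> K \<longleftrightarrow> b \<in> K"
    and ab: "(a, b) \<in> interchange" and b: "b \<in> K"
  shows "a \<in> K"
proof (rule ccontr)
  assume a: "a \<notin> K"
  obtain B where B: "min_basis B" "b \<in> B" "min_basis ((B - {b}) \<union> {a})"
    using ab by (auto simp: interchange_def)
  let ?K = "\<lambda>B. {x \<in> B. w x = w b \<and> x \<in> K}"
  have "card (?K ((B - {b}) \<union> {a})) = card (?K B)"
    using card_level_Int_eq[OF M B(1) K] card_level_Int_eq[OF M B(3) K] by presburger
  moreover have "?K ((B - {b}) \<union> {a}) \<subset> ?K B"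
    using a b B(2) by blast
  then have "card (?K ((B - {b}) \<union> {a})) < card (?K B)"
    using min_basisD(2)[OF B(1)] by (intro psubset_card_mono) auto
  ultimately show False by simp
qed

lemma interchange_subset_equiv:
  assumes M: "min_basis M" and s: "equiv relevant s" "pivots M \<subseteq> s"
  shows "interchange \<subseteq> s"
proof (rule subrelI)
  fix a b assume ab: "(a, b) \<in> interchange"
  have s': "sym s" "trans s" "refl_on relevant s" using s(1) by (auto simp: equiv_def)
  \<comment> \<open>The class of \<open>b\<close> under \<open>s\<close> serves as
    \<open>K\<close>.\<close>
  have "a \<in> {c. (c, b) \<in> s}"
  proof (rule interchange_closed[OF M _ ab])
    show "c \<in> {c. (c, b) \<in> s} \<longleftrightarrow> d \<in> {c. (c, b) \<in> s}" if "(c, d) \<in> pivots M" for c d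
      using that s(2) s' by (auto dest: symD transD)
    show "b \<in> {c. (c, b) \<in> s}"
      using ab s'(3) by (auto simp: interchange_def refl_on_def)
  qed
  then show "(a, b) \<in> s" by simp
qed

section \<open>Elements joined by pivots are interchangeable\<close>

abbreviation links :: "'a set \<Rightarrow> ('a \<times> 'a) set" where
  "links M \<equiv> pivots M \<union> (pivots M)\<inverse>"

text \<open>In matrix terms, a pivot at \<open>(f, e)\<close> changes entry \<open>(a, b)\<close> by
  a multiple of the product of entries \<open>(a, e)\<close> and \<open>(f, b)\<close>; if one of
  these vanishes, a nonzero entry stays nonzero. Equal weights make absence from
  \<open>pivots\<close> mean a zero entry.\<close>

lemma pivots_preserved:
  assumes fe: "(f, e) \<in> pivots M" and ab: "(a, b) \<in> pivots M" and "a \<noteq> f" "b \<noteq> e" "w a = w f"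
    and "(a, e) \<notin> pivots M \<or> (f, b) \<notin> pivots M"
  shows "(a, b) \<in> pivots (insert f (M - {e}))"
proof -
  have "a \<notin> cl (insert f (M - {e} - {b}))"
  proof
    assume a: "a \<in> cl (insert f (M - {e} - {b}))"
    have not: "a \<notin> cl (M - {b})" "f \<notin> cl (M - {e})" using ab fe by (auto simp: pivots_def)
    have "a \<in> cl (M - {e}) \<or> f \<in> cl (M - {b})"
      using assms by (auto simp: pivots_def)
    then show False
    proof
      assume ae: "a \<in> cl (M - {e})"
      have "a \<notin> cl (M - {e} - {b})" using not(1) cl_mono_in by (meson Diff_mono Diff_subset order_refl)
      then have "f \<in> cl (insert a (M - {e} - {b}))" using cl_exchange[OF a] by blast
      then show False using cl_insert_absorb[OF ae, of "M - {e} - {b}" f] not(2) by blast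
    next
      assume "f \<in> cl (M - {b})"
      then show False using cl_insert_absorb[of f "M - {b}" "M - {e} - {b}" a] a not(1) by blast
    qed
  qed
  moreover have "insert f (M - {e} - {b}) = insert f (M - {e}) - {b}"
    using fe ab by (auto simp: pivots_def)
  ultimately show ?thesis
    using assms by (auto simp: pivots_def)
qed

text \<open>The complementary case: a zero entry at \<open>(a, b)\<close> becomes nonzero when both
  entries \<open>(a, e)\<close> and \<open>(f, b)\<close> are nonzero.\<close>

lemma pivots_created:
  assumes fe: "(f, e) \<in> pivots M" and ae: "(a, e) \<in> pivots M" and fb: "(f, b) \<in> pivots M"
    and ab: "(a, b) \<notin> pivots M"
  shows "(a, b) \<in> pivots (insert f (M - {e}))"
proof -
  have not: "a \<notin> cl (M - {e})" "f \<notin> cl (M - {b})" "a \<in> cl (M - {b})"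
    using assms by (auto simp: pivots_def)
  have "a \<notin> cl (insert f (M - {e} - {b}))"
  proof
    assume a: "a \<in> cl (insert f (M - {e} - {b}))"
    have "a \<notin> cl (M - {e} - {b})" using not(1) cl_mono_in by blast
    then have "f \<in> cl (insert a (M - {e} - {b}))" using cl_exchange[OF a] by blast
    then show False using cl_insert_absorb[OF not(3), of "M - {e} - {b}" f] not(2) by blast
  qed
  moreover have "insert f (M - {e} - {b}) = insert f (M - {e}) - {b}"
    using fe fb by (auto simp: pivots_def)
  moreover have "a \<noteq> f" "b \<noteq> e" using assms by auto
  ultimately show ?thesis
    using assms by (auto simp: pivots_def)
qed

text \<open>Induction on the length with \<open>M\<close> varying: a chord shortens the path over
  the same basis, and a chordless path of length at least 3 is shortened by two through an exchange
  that changes \<open>M\<close>.\<close>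

lemma links_path_interchange:
  assumes "min_basis M" "x \<in> relevant" "(x, y) \<in> links M ^^ k"
  shows "(x, y) \<in> interchange"
  using assms
proof (induction k arbitrary: M rule: less_induct)
  case (less k)
  note M = \<open>min_basis M\<close>
  obtain p where p0: "p 0 = x" and pk: "p k = y"
    and step: "\<And>i. i < k \<Longrightarrow> (p i, p (Suc i)) \<in> links M"
    using less.prems(3) unfolding relpow_fun_conv by blast
  have path: "(p i, p j) \<in> links M' ^^ (j - i)"
    if "i \<le> j" "\<And>l. i \<le> l \<Longrightarrow> l < j \<Longrightarrow> (p l, p (Suc l)) \<in> links M'" for i j M'
    unfolding relpow_fun_conv
    by (rule exI[of _ "\<lambda>l. p (i + l)"]) (use that in auto)
  show ?case
  proof (cases "\<exists>i j. Suc i < j \<and> j \<le> k \<and> (p i, p j) \<in> links M")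
    case True
    then obtain i j where ij: "Suc i < j" "j \<le> k" "(p i, p j) \<in> links M" by blast
    have "(p 0, p i) \<in> links M ^^ i" "(p j, p k) \<in> links M ^^ (k - j)"
      using path[of 0 i M] path[of j k M] step ij by auto
    then have "(p 0, p k) \<in> links M ^^ (Suc i + (k - j))"
      using ij(3) unfolding relpow_add by (meson relcompI relpow_Suc_I)
    then show ?thesis
      using less.IH[of "Suc i + (k - j)" M] ij less.prems p0 pk by simp
  next
    case False
    then have chordless: "(p i, p j) \<notin> links M" if "Suc i < j" "j \<le> k" for i j
      using that by blast
    have weight: "i \<le> k \<Longrightarrow> w (p i) = w x" for i
    proof (induction i)
      case (Suc i)
      then show ?case using step[of i] by (auto simp: pivots_def)
    qed (simp add: p0)
    consider "k = 0" | "k = 1" | "k = 2" | "k \<ge> 3" by linarith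
    then show ?thesis
    proof cases
      case 1
      then show ?thesis using p0 pk less.prems interchange_refl by simp
    next
      case 2
      then show ?thesis
        using step[of 0] p0 pk pivots_subset_interchange[OF M] interchange_sym by auto
    next
      case 3
      then have 2: "(x, p 1) \<in> links M" "(p 1, y) \<in> links M"
        using step[of 0] step[of 1] p0 pk by (auto simp: numeral_2_eq_2)
      show ?thesis
      proof (cases "x = y")
        case True
        then show ?thesis using less.prems interchange_refl by simp
      next
        case xy: False
        have rel: "y \<in> relevant" using 2 min_basisD(6)[OF M] by (auto simp: pivots_def)
        show ?thesis
        proof (cases "x \<in> M")
          case True
          then have in_piv: "(p 1, x) \<in> pivots M" "(p 1, y) \<in> pivots M"
            using 2 by (auto simp: pivots_def)
          let ?B = "insert (p 1) (M - {x})"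
          \<comment> \<open>Both end points occur in the expansion of \<open>p 1\<close>, so
            \<open>p 1\<close> can replace either one; the two resulting bases differ by trading
            \<open>y\<close> for \<open>x\<close>.\<close>
          have "?B - {y} \<union> {x} = insert (p 1) (M - {y})"
            using True xy in_piv by (auto simp: pivots_def)
          then have "min_basis ?B" "min_basis (?B - {y} \<union> {x})" "y \<in> ?B"
            using min_basis_exchange[OF M in_piv(1)] min_basis_exchange[OF M in_piv(2)] in_piv xy
            by (auto simp: pivots_def)
          then show ?thesis using rel less.prems unfolding interchange_def by blast
        next
          case False
          then have in_piv: "(x, p 1) \<in> pivots M" "(y, p 1) \<in> pivots M"
            using 2 by (auto simp: pivots_def)
          let ?B = "insert y (M - {p 1})"
          have "?B - {y} \<union> {x} = insert x (M - {p 1})"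
            using in_piv by (auto simp: pivots_def)
          then have "min_basis ?B" "min_basis (?B - {y} \<union> {x})" "y \<in> ?B"
            using min_basis_exchange[OF M in_piv(1)] min_basis_exchange[OF M in_piv(2)] by auto
          then show ?thesis using rel less.prems unfolding interchange_def by blast
        qed
      qed
    next
      case 4
      have steps: "(p 0, p 1) \<in> links M" "(p 1, p 2) \<in> links M" "(p 2, p 3) \<in> links M"
        using step[of 0] step[of 1] step[of 2] 4 by (auto simp: eval_nat_numeral)
      \<comment> \<open>A repetition would be a chord from \<open>p 0\<close> or \<open>p 1\<close>,
        except that \<open>p 3\<close> and \<open>p 2\<close> differ because they lie on opposite
        sides of \<open>M\<close>.\<close>
      have ne: "p j \<noteq> p 1" "p j \<noteq> p 2" if "3 \<le> j" "j \<le> k" for j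
      proof -
        show "p j \<noteq> p 1" using chordless[of 0 j] steps that by auto
        show "p j \<noteq> p 2"
        proof
          assume eq: "p j = p 2"
          show False
          proof (cases "j = 3")
            case True
            then show False using steps eq by (auto simp: pivots_def)
          next
            case False
            then show False using chordless[of 1 j] steps that eq by auto
          qed
        qed
      qed
      have no03: "(p 0, p 3) \<notin> links M" using chordless[of 0 3] 4 by simp
      have no1: "(p 1, p j) \<notin> links M" if "3 \<le> j" "j \<le> k" for j
        using chordless[of 1 j] that by simp
      \<comment> \<open>Pivots lead from outside \<open>M\<close> into \<open>M\<close>, so the side
        of \<open>x\<close> decides which of \<open>p 1\<close> and \<open>p 2\<close> enters the
        basis.\<close>
      define f e where "f = (if x \<in> M then p 1 else p 2)" and "e = (if x \<in> M then p 2 else p 1)"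
      have fe: "(f, e) \<in> pivots M"
        using steps p0 by (auto simp: f_def e_def pivots_def)
      let ?M = "insert f (M - {e})"
      have min: "min_basis ?M" by (rule min_basis_exchange[OF M fe])
      have first: "(p 0, p 3) \<in> links ?M"
      proof (cases "x \<in> M")
        case True
        then have "(p 1, p 0) \<in> pivots M" "(p 3, p 2) \<in> pivots M"
          using steps p0 by (auto simp: pivots_def)
        then show ?thesis
          using pivots_created[of f e M "p 3" "p 0"] fe no03 True by (simp add: f_def e_def)
      next
        case False
        then have "(p 0, p 1) \<in> pivots M" "(p 2, p 3) \<in> pivots M"
          using steps p0 by (auto simp: pivots_def)
        then show ?thesis
          using pivots_created[of f e M "p 0" "p 3"] fe no03 False by (simp add: f_def e_def)
      qed
      \<comment> \<open>One of \<open>f\<close>, \<open>e\<close> is \<open>p 1\<close>, which has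
        no link to later vertices; so one of the two critical entries vanishes.\<close>
      have keep: "(a, b) \<in> pivots ?M"
        if ab: "(a, b) \<in> pivots M" and ij: "a = p i" "b = p j" "3 \<le> i" "i \<le> k" "3 \<le> j" "j \<le> k"
        for a b i j
      proof (rule pivots_preserved[OF fe ab])
        show "a \<noteq> f" "b \<noteq> e" using ne[of i] ne[of j] ij by (auto simp: f_def e_def)
        show "w a = w f" using weight[of i] weight[of 1] weight[of 2] ij by (auto simp: f_def)
        show "(a, e) \<notin> pivots M \<or> (f, b) \<notin> pivots M"
          using no1[of i] no1[of j] ij by (auto simp: f_def e_def)
      qed
      have rest: "(p l, p (Suc l)) \<in> links ?M" if "3 \<le> l" "l < k" for l
        using step[OF that(2)] keep[of "p l" "p (Suc l)" l "Suc l"]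
          keep[of "p (Suc l)" "p l" "Suc l" l] that by auto
      have "(p 3, p k) \<in> links ?M ^^ (k - 3)"
        using path[of 3 k ?M] rest 4 by simp
      then have "(x, y) \<in> links ?M ^^ Suc (k - 3)"
        using first p0 pk by (meson relpow_Suc_I2)
      then show ?thesis
        using less.IH[of "Suc (k - 3)" ?M] min less.prems 4 by simp
    qed
  qed
qed

text \<open>Transitivity is not visible from the definition; it comes from identifying
  \<open>interchange\<close> with reachability along \<open>links M\<close>, cut down to
  \<open>relevant\<close> because \<open>rtrancl\<close> is reflexive on the whole type.\<close>

lemma equiv_interchange:
  assumes M: "min_basis M"
  shows "equiv relevant interchange"
proof -
  let ?s = "(links M)\<^sup>* \<inter> relevant \<times> relevant"
  have "sym (links M)" by (auto intro: symI)
  then have "sym ((links M)\<^sup>*)" by (rule sym_rtrancl)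
  then have "equiv relevant ?s"
    by (auto simp: equiv_def refl_on_def sym_def trans_def)
  moreover have "pivots M \<subseteq> ?s"
    using min_basisD(6)[OF M] by (auto simp: pivots_def)
  ultimately have "interchange \<subseteq> ?s" by (rule interchange_subset_equiv[OF M])
  moreover have "?s \<subseteq> interchange"
    using links_path_interchange[OF M] by (auto simp: rtrancl_power)
  ultimately have "interchange = ?s" by (rule equalityI)
  then show ?thesis using \<open>equiv relevant ?s\<close> by (simp only:)
qed

theorem interchange_eq_least_equiv:
  assumes "min_basis M"
  shows "interchange = least_equiv relevant (pivots M)"
proof (rule equalityI)
  show "interchange \<subseteq> least_equiv relevant (pivots M)"
    using interchange_subset_equiv[OF assms] unfolding least_equiv_def by (intro Inter_greatest) blast
  have "pivots M \<subseteq> interchange"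
    using pivots_subset_interchange[OF assms] by auto
  then show "least_equiv relevant (pivots M) \<subseteq> interchange"
    using equiv_interchange[OF assms] unfolding least_equiv_def by (intro Inter_lower) simp
qed

end

section \<open>The cycle matroid\<close>

definition cycle_closure :: "'e set set \<Rightarrow> 'e set set" where
  "cycle_closure A = {C. char_vec C \<in> gf2.span (char_vec ` A)}"

lemma cycle_closure_iff: "C \<in> cycle_closure A \<longleftrightarrow> char_vec C \<in> gf2.span (char_vec ` A)"
  unfolding cycle_closure_def by (rule mem_Collect_eq)

text \<open>The laws are those of the linear span, pulled back along \<open>char_vec\<close>. None
  of them mentions the weight, so the predicate takes two arguments.\<close>

lemma weighted_matroid_cycles:
  assumes "finite_simple_graph V E"
  shows "weighted_matroid (cycles V E) cycle_closure"
proof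
  show "finite (cycles V E)" by (rule finite_cycles[OF assms])
  show "A \<subseteq> cycle_closure A" for A :: "'a set set set"
    unfolding subset_iff cycle_closure_iff using gf2.span_base by blast
  show "cycle_closure A \<subseteq> cycle_closure B" if "A \<subseteq> cycle_closure B" for A B :: "'a set set set"
  proof -
    have "char_vec ` A \<subseteq> gf2.span (char_vec ` B)"
      using that unfolding subset_iff cycle_closure_iff by blast
    then have "gf2.span (char_vec ` A) \<subseteq> gf2.span (char_vec ` B)"
      by (rule gf2.span_minimal[OF _ gf2.subspace_span])
    then show ?thesis
      unfolding subset_iff cycle_closure_iff by blast
  qed
  show "y \<in> cycle_closure (insert x A)" if "x \<in> cycle_closure (insert y A)" "x \<notin> cycle_closure A"
    for x y :: "'a set set" and A
    using that gf2.in_span_insert unfolding cycle_closure_iff image_insert by blast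
qed

lemma independent_iff_cycle_closure:
  "gf2.independent (char_vec ` B) \<longleftrightarrow> (\<forall>b\<in>B. b \<notin> cycle_closure (B - {b}))"
proof -
  have diff: "char_vec ` (B - {b}) = char_vec ` B - {char_vec b}" for b
    by (auto simp: char_vec_inject)
  show ?thesis unfolding gf2.dependent_def cycle_closure_iff diff by blast
qed

text \<open>One inclusion suffices, since the cycles form a subspace and already contain the span of
  \<open>B\<close>.\<close>

lemma cycle_basis_iff_closure:
  assumes "finite_simple_graph V E"
  shows "cycle_basis V E B \<longleftrightarrow> B \<subseteq> cycles V E \<and>
    (\<forall>b\<in>B. b \<notin> cycle_closure (B - {b})) \<and> cycles V E \<subseteq> cycle_closure B"
proof -
  have "gf2.span (char_vec ` B) = char_vec ` cycles V E \<longleftrightarrow> cycles V E \<subseteq> cycle_closure B"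
    if "B \<subseteq> cycles V E"
    using gf2.span_minimal[OF image_mono[OF that] subspace_cycles[OF assms]]
    unfolding subset_iff[of "cycles V E"] cycle_closure_iff by blast
  then show ?thesis
    unfolding cycle_basis_def independent_iff_cycle_closure by blast
qed

text \<open>If \<open>b\<close> occurs, solving the expansion for \<open>b\<close> shows that
  spanning \<open>C\<close> without \<open>b\<close> would make \<open>B\<close> dependent; if not,
  the expansion itself spans \<open>C\<close> without \<open>b\<close>.\<close>

lemma in_expansion_iff:
  assumes "finite_simple_graph V E" "cycle_basis V E B" "C \<in> cycles V E" "b \<in> B"
  shows "b \<in> expansion B C \<longleftrightarrow> C \<notin> cycle_closure (B - {b})"
proof -
  let ?F = "expansion B C"
  have F: "?F \<subseteq> B" "(\<Sum>D\<in>?F. char_vec D) = char_vec C"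
    using theI'[OF expansion_unique[OF assms(1-3)]] unfolding expansion_def by auto
  have "finite B" using assms finite_cycles finite_subset by (metis cycle_basis_def)
  then have fin: "finite ?F" using F finite_subset by blast
  have span: "(\<Sum>D\<in>S. char_vec D) \<in> gf2.span (char_vec ` (B - {b}))" if "S \<subseteq> B - {b}" for S
    using that by (intro gf2.span_sum gf2.span_base) auto
  show ?thesis
  proof
    assume b: "b \<in> ?F"
    show "C \<notin> cycle_closure (B - {b})"
    proof
      assume C: "C \<in> cycle_closure (B - {b})"
      have "char_vec b = char_vec C - (\<Sum>D\<in>?F - {b}. char_vec D)"
        using F(2) sum.remove[OF fin b, of char_vec] by (metis add_diff_cancel_right')
      then have "char_vec b \<in> gf2.span (char_vec ` (B - {b}))"
        using C span[of "?F - {b}"] F(1) gf2.span_diff unfolding cycle_closure_iff by fastforce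
      then show False
        using assms(2,4) unfolding cycle_basis_iff_closure[OF assms(1)] cycle_closure_def by blast
    qed
  next
    assume "C \<notin> cycle_closure (B - {b})"
    then show "b \<in> ?F"
      using span[of ?F] F unfolding cycle_closure_iff by auto
  qed
qed

theorem theorem2:
  fixes V :: "'v set" and E :: "'v set set" and M :: "'v set set set"
  assumes "finite_simple_graph V E" and "mcb V E M"
  shows "(\<forall>C1 C2. C2 \<in> M \<longrightarrow> C1 \<in> relevant_cycles V E - M \<longrightarrow> C2 \<in> expansion M C1 \<longrightarrow>
             card C1 = card C2 \<longrightarrow> (C1, C2) \<in> pi_rel V E) \<and>
         relevant_cycles V E // pi_rel V E =
           relevant_cycles V E // least_equiv (relevant_cycles V E) (exchange_pairs V E M)"
proof -
  interpret weighted_matroid "cycles V E" cycle_closure card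
    by (rule weighted_matroid_cycles[OF assms(1)])
  have "basis = cycle_basis V E"
    by (rule ext) (simp add: basis_def indep_def cycle_basis_iff_closure[OF assms(1)])
  then have mcb: "min_basis = mcb V E"
    by (auto simp: fun_eq_iff min_basis_def mcb_def)
  then have M: "min_basis M" using assms(2) by simp
  have rel: "relevant = relevant_cycles V E"
    by (simp add: relevant_def relevant_cycles_def mcb)
  have pi: "interchange = pi_rel V E"
    by (simp add: interchange_def pi_rel_def mcb rel)
  have "cycle_basis V E M" using assms(2) by (simp add: mcb_def)
  then have pairs: "pivots M = exchange_pairs V E M"
    using in_expansion_iff[OF assms(1)] relevant_subset
    unfolding pivots_def exchange_pairs_def rel by blast
  \<comment> \<open>Part (i) says that pivots are interchanges. For (ii) the two relations
    themselves coincide, hence so do their classes.\<close>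
  show ?thesis
    using interchange_eq_least_equiv[OF M] pivots_subset_interchange[OF M]
    unfolding pi rel pairs by (auto simp: exchange_pairs_def)
qed

end
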